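(* Fix $s\ge2$ and $M>0$. Let $H_n\sim\mathsf{H}_s(n,\boldsymbol\beta_s)$ with $\boldsymbol\beta_s\in\mathcal B_M$, and for $\boldsymbol\gamma\in\mathcal B_M$ and $\varepsilon=\varepsilon_n>0$ consider the testing problem $$H_0:\boldsymbol\beta_s=\boldsymbol\gamma\quad\text{versus}\quad H_1:\|\boldsymbol\beta_s-\boldsymbol\gamma\|_\infty\ge\varepsilon.$$ Then the following hold. (a) If $\varepsilon\gg\sqrt{\frac{\log n}{n^{s-1}}}$, the test $$\phi^{\max}_{n,s}=\mathbf 1\left\{\|\hat{\boldsymbol\beta}_s-\boldsymbol\gamma\|_\infty\ge 2C\sqrt{\frac{\log n}{n^{s-1}}}\right\}$$ is asymptotically powerful: for all $\boldsymbol\gamma\in\mathcal B_M$, $\lim_{n\to\infty}\mathcal R(\phi^{\max}_{n,s},\boldsymbol\gamma)=0$. (b) If $\varepsilon\ll\sqrt{\frac{\log n}{n^{s-1}}}$, all tests are asymptotically powerless: for every sequence of test functions $\psi_n$ there exists $\boldsymbol\gamma\in\mathcal B_M$ such that $\lim_{n\to\infty}\mathcal R(\psi_n,\boldsymbol\gamma)=1$.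
   Context: $[n]=\{1,\ldots,n\}$; $\binom{[n]}{s}$ is the collection of $s$-element subsets of $[n]$; $\mathcal B_M=\{\boldsymbol x\in\mathbb R^n:\|\boldsymbol x\|_\infty\le M\}$. The $s$-uniform hypergraph $\boldsymbol\beta$-model $\mathsf{H}_s(n,\boldsymbol\beta)$ is the random $s$-uniform hypergraph on $[n]$ in which each $\{v_1,\ldots,v_s\}\in\binom{[n]}{s}$ is a hyperedge independently with probability $\frac{e^{\beta_{v_1}+\cdots+\beta_{v_s}}}{1+e^{\beta_{v_1}+\cdots+\beta_{v_s}}}$; $\mathbb P_{\boldsymbol\kappa}$ is its law for $\boldsymbol\beta=\boldsymbol\kappa$. A test function $\psi_n$ is a $\{0,1\}$-valued function of $H_n$; its worst-case risk is $$\mathcal R(\psi_n,\boldsymbol\gamma)=\mathbb P_{\boldsymbol\gamma}(\psi_n=1)+\sup_{\boldsymbol\gamma'\in\mathcal B_M:\|\boldsymbol\gamma'-\boldsymbol\gamma\|_\infty\ge\varepsilon}\mathbb P_{\boldsymbol\gamma'}(\psi_n=0)$$ (supremum over the empty set is $0$). Here $\boldsymbol\gamma=\boldsymbol\gamma_n$ is a sequence indexed by $n$ (so statements "for all/there exists $\boldsymbol\gamma\in\mathcal B_M$" concern such sequences). With $d_s(v)$ the number of hyperedges containing $v$, the ML estimate $\hat{\boldsymbol\beta}_s$ is the minimizer over $\boldsymbol\beta\in\mathbb R^n$ of $\sum_{\{v_1,\ldots,v_s\}\in\binom{[n]}{s}}\log(1+e^{\beta_{v_1}+\cdots+\beta_{v_s}})-\sum_{v}\beta_v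 d_s(v)$ (it exists uniquely with probability $1-o(1)$; defined arbitrarily otherwise). The constant $C=C(s,M)>0$ in the test is chosen so that $\mathbb P_{\boldsymbol\kappa}\big(\|\hat{\boldsymbol\beta}_s-\boldsymbol\kappa\|_\infty\le C\sqrt{\log n/n^{s-1}}\big)\to1$ for all (sequences) $\boldsymbol\kappa\in\mathcal B_M$; such a constant exists. $a_n\ll b_n$ means $a_n/b_n\to0$, and $a_n\gg b_n$ means $a_n/b_n\to\infty$. *)

theory Defs
  imports "HOL-Probability.Probability" "HOL-Probability.Product_PMF"
begin

text \<open>
  The dimension \<open>n\<close> varies, so \<open>\<real>\<close>-vectors indexed by \<open>{1..n}\<close> are functions
  \<^typ>\<open>nat \<Rightarrow> real\<close> that are extensional on \<open>{1..n}\<close>; extensionality makes equality of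
  such functions coincide with equality of vectors, which matters for uniqueness of
  the maximum likelihood estimate.
\<close>

definition vecs :: "nat \<Rightarrow> (nat \<Rightarrow> real) set" where
  "vecs n = {1..n} \<rightarrow>\<^sub>E UNIV"

text \<open>Inserting 0 only serves to give the value 0 when \<open>n = 0\<close>.\<close>

definition linf_norm :: "nat \<Rightarrow> (nat \<Rightarrow> real) \<Rightarrow> real" where
  "linf_norm n x = Max (insert 0 ((\<lambda>v. \<bar>x v\<bar>) ` {1..n}))"

definition linf_dist :: "nat \<Rightarrow> (nat \<Rightarrow> real) \<Rightarrow> (nat \<Rightarrow> real) \<Rightarrow> real" where
  "linf_dist n x y = linf_norm n (\<lambda>v. x v - y v)"

definition linf_ball :: "nat \<Rightarrow> real \<Rightarrow> (nat \<Rightarrow> real) set" where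
  "linf_ball n M = {x \<in> vecs n. linf_norm n x \<le> M}"

text \<open>An \<open>s\<close>-uniform hypergraph on \<open>{1..n}\<close> is represented by its set of hyperedges,
  a subset of \<open>all_edges s n\<close>.\<close>

definition all_edges :: "nat \<Rightarrow> nat \<Rightarrow> nat set set" where
  "all_edges s n = {e. e \<subseteq> {1..n} \<and> card e = s}"

definition edge_prob :: "(nat \<Rightarrow> real) \<Rightarrow> nat set \<Rightarrow> real" where
  "edge_prob \<beta> e = exp (\<Sum>v\<in>e. \<beta> v) / (1 + exp (\<Sum>v\<in>e. \<beta> v))"

definition beta_model :: "nat \<Rightarrow> nat \<Rightarrow> (nat \<Rightarrow> real) \<Rightarrow> nat set set pmf" where
  "beta_model s n \<beta> =
     map_pmf (\<lambda>X. {e \<in> all_edges s n. X e})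
       (Pi_pmf (all_edges s n) False (\<lambda>e. bernoulli_pmf (edge_prob \<beta> e)))"

definition degree :: "nat set set \<Rightarrow> nat \<Rightarrow> nat" where
  "degree H v = card {e \<in> H. v \<in> e}"

definition neg_loglik :: "nat \<Rightarrow> nat \<Rightarrow> nat set set \<Rightarrow> (nat \<Rightarrow> real) \<Rightarrow> real" where
  "neg_loglik s n H \<beta> =
     (\<Sum>e\<in>all_edges s n. ln (1 + exp (\<Sum>v\<in>e. \<beta> v)))
     - (\<Sum>v\<in>{1..n}. \<beta> v * real (degree H v))"

abbreviation is_ML_point :: "nat \<Rightarrow> nat \<Rightarrow> nat set set \<Rightarrow> (nat \<Rightarrow> real) \<Rightarrow> bool" where
  "is_ML_point s n H \<beta> \<equiv> is_arg_min (neg_loglik s n H) (\<lambda>b. b \<in> vecs n) \<beta>"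

text \<open>\<open>B\<close> maps each hypergraph to the unique minimizer of the negative log-likelihood
  whenever there is one; its values on the remaining hypergraphs are arbitrary vectors.\<close>

definition is_ML_estimator ::
    "nat \<Rightarrow> nat \<Rightarrow> (nat set set \<Rightarrow> nat \<Rightarrow> real) \<Rightarrow> bool" where
  "is_ML_estimator s n B \<longleftrightarrow>
     (\<forall>H. H \<subseteq> all_edges s n \<longrightarrow>
        B H \<in> vecs n \<and> ((\<exists>!\<beta>. is_ML_point s n H \<beta>) \<longrightarrow> is_ML_point s n H (B H)))"

definition rate :: "nat \<Rightarrow> nat \<Rightarrow> real" where
  "rate s n = sqrt (ln (real n) / real n ^ (s - 1))"

text \<open>The quantification over \<open>\<kappa>\<close> is over sequences of parameters, one for each \<open>n\<close>.\<close>

definition valid_const ::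
    "nat \<Rightarrow> real \<Rightarrow> (nat \<Rightarrow> nat set set \<Rightarrow> nat \<Rightarrow> real) \<Rightarrow> real \<Rightarrow> bool" where
  "valid_const s M B C \<longleftrightarrow> C > 0 \<and>
     (\<forall>\<kappa>. (\<forall>n. \<kappa> n \<in> linf_ball n M) \<longrightarrow>
        (\<lambda>n. measure_pmf.prob (beta_model s n (\<kappa> n))
               {H. linf_dist n (B n H) (\<kappa> n) \<le> C * rate s n}) \<longlonglongrightarrow> 1)"

text \<open>Test functions are Boolean-valued, with \<^const>\<open>True\<close> standing for the value 1
  (rejection).  Since probabilities are nonnegative, inserting 0 changes the supremum only
  when there is no alternative, where it makes it 0.\<close>

definition risk ::
    "nat \<Rightarrow> nat \<Rightarrow> real \<Rightarrow> real \<Rightarrow> (nat set set \<Rightarrow> bool) \<Rightarrow> (nat \<Rightarrow> real) \<Rightarrow> real" where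
  "risk s n M \<epsilon> \<psi> \<gamma> =
     measure_pmf.prob (beta_model s n \<gamma>) {H. \<psi> H}
     + Sup (insert 0 ((\<lambda>\<gamma>'. measure_pmf.prob (beta_model s n \<gamma>') {H. \<not> \<psi> H}) `
           {\<gamma>' \<in> linf_ball n M. linf_dist n \<gamma>' \<gamma> \<ge> \<epsilon>}))"

definition phi_max ::
    "nat \<Rightarrow> nat \<Rightarrow> (nat set set \<Rightarrow> nat \<Rightarrow> real) \<Rightarrow> real \<Rightarrow> (nat \<Rightarrow> real) \<Rightarrow> nat set set \<Rightarrow> bool" where
  "phi_max s n B C \<gamma> H \<longleftrightarrow> linf_dist n (B H) \<gamma> \<ge> 2 * C * rate s n"

end

theory Submission
  imports Defs
begin

text \<open>
  Part (a): an alternative at distance at least \<open>\<epsilon> \<ge> 3 C rate\<close> from \<open>\<gamma>\<close> is missed only if the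
  estimate is farther than \<open>C rate\<close> from the truth, and the defining property of \<open>C\<close>, applied to a
  sequence of nearly worst alternatives, makes this uniformly unlikely.

  Part (b): a parameter \<open>\<gamma>\<close> that nearly minimizes the rejection probability over the whole ball has
  risk at most \<open>1 + o(1)\<close>.  For the lower bound, move one coordinate of \<open>\<gamma>\<close> by \<open>\<epsilon>\<close> towards 0,
  so as to stay in the ball,
  and average over the coordinate.  The chi-square divergence of this mixture from the null is
  at most \<open>exp (K \<epsilon>\<^sup>2 n\<^bsup>s-1\<^esup>) / n + exp (K \<epsilon>\<^sup>2 n\<^bsup>s-2\<^esup>) - 1\<close>, where the first term comes from equal
  coordinates and the rest from distinct ones; it tends to 0 when \<open>\<epsilon>\<close> is \<open>o(rate)\<close>.
\<close>

section \<open>The sup norm\<close>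

text \<open>The conjunct \<open>0 \<le> c\<close> comes from the inserted 0; it is all that remains
  when \<open>n = 0\<close>.\<close>

lemma linf_norm_le_iff: "linf_norm n x \<le> c \<longleftrightarrow> 0 \<le> c \<and> (\<forall>v\<in>{1..n}. \<bar>x v\<bar> \<le> c)"
  unfolding linf_norm_def by (subst Max_le_iff) auto

lemma linf_norm_nonneg: "0 \<le> linf_norm n x"
  using linf_norm_le_iff[of n x "linf_norm n x"] by simp

lemma abs_le_linf_norm: "v \<in> {1..n} \<Longrightarrow> \<bar>x v\<bar> \<le> linf_norm n x"
  using linf_norm_le_iff[of n x "linf_norm n x"] by simp

text \<open>The intermediate point stands first in both distances, so symmetry of
  \<open>linf_dist\<close> need not be shown.\<close>

lemma linf_dist_triangle: "linf_dist n x z \<le> linf_dist n y x + linf_dist n y z"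
proof -
  have "\<bar>x v - z v\<bar> \<le> linf_dist n y x + linf_dist n y z" if "v \<in> {1..n}" for v
    using abs_le_linf_norm[OF that, of "\<lambda>v. y v - x v"] abs_le_linf_norm[OF that, of "\<lambda>v. y v - z v"]
    unfolding linf_dist_def by linarith
  moreover have "0 \<le> linf_dist n y x + linf_dist n y z"
    unfolding linf_dist_def by (intro add_nonneg_nonneg linf_norm_nonneg)
  ultimately show ?thesis
    unfolding linf_dist_def[of n x z] linf_norm_le_iff by blast
qed

text \<open>At \<open>n = 1\<close> the logarithm, and with it the rate, vanishes; division by the
  rate is therefore used only from \<open>n = 2\<close> on.\<close>

lemma rate_pos: "n \<ge> 2 \<Longrightarrow> rate s n > 0"
  unfolding rate_def by simp

lemma filterlim_rate_times_const_le:
  assumes "filterlim (\<lambda>n. \<epsilon> n / rate s n) at_top sequentially"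
  shows "\<forall>\<^sub>F n in sequentially. c * rate s n \<le> \<epsilon> n"
proof -
  have "\<forall>\<^sub>F n in sequentially. c \<le> \<epsilon> n / rate s n"
    using assms by (auto simp: filterlim_at_top)
  then show ?thesis
    using eventually_ge_at_top[of 2]
  proof eventually_elim
    case (elim n)
    then show ?case using rate_pos[of n s] by (simp add: pos_le_divide_eq)
  qed
qed

section \<open>The risk\<close>

abbreviation miss_probs ::
    "nat \<Rightarrow> nat \<Rightarrow> real \<Rightarrow> real \<Rightarrow> (nat set set \<Rightarrow> bool) \<Rightarrow> (nat \<Rightarrow> real) \<Rightarrow> real set" where
  "miss_probs s n M \<epsilon> \<psi> \<gamma> \<equiv>
     (\<lambda>\<gamma>'. measure_pmf.prob (beta_model s n \<gamma>') {H. \<not> \<psi> H}) `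
       {\<gamma>' \<in> linf_ball n M. linf_dist n \<gamma>' \<gamma> \<ge> \<epsilon>}"

lemma prob_not: "measure_pmf.prob p {x. \<not> P x} = 1 - measure_pmf.prob p {x. P x}"
proof -
  have "{x. \<not> P x} = space (measure_pmf p) - {x. P x}" by auto
  then show ?thesis using measure_pmf.prob_compl[of "{x. P x}" p] by simp
qed

text \<open>Probabilities are at most 1. Boundedness is what lets the real supremum dominate its
  members.\<close>

lemma bdd_above_miss_probs: "bdd_above (insert 0 (miss_probs s n M \<epsilon> \<psi> \<gamma>))"
  by (auto intro!: bdd_aboveI[of _ 1])

lemma miss_prob_le_Sup:
  assumes "\<gamma>' \<in> linf_ball n M" "linf_dist n \<gamma>' \<gamma> \<ge> \<epsilon>"
  shows "measure_pmf.prob (beta_model s n \<gamma>') {H. \<not> \<psi> H} \<le> Sup (insert 0 (miss_probs s n M \<epsilon> \<psi> \<gamma>))"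
  using assms by (intro cSup_upper bdd_above_miss_probs) auto

lemma Sup_miss_probs_le:
  assumes "0 \<le> c"
    and "\<And>\<gamma>'. \<gamma>' \<in> linf_ball n M \<Longrightarrow> linf_dist n \<gamma>' \<gamma> \<ge> \<epsilon> \<Longrightarrow>
           measure_pmf.prob (beta_model s n \<gamma>') {H. \<not> \<psi> H} \<le> c"
  shows "Sup (insert 0 (miss_probs s n M \<epsilon> \<psi> \<gamma>)) \<le> c"
  using assms by (intro cSup_least) auto

lemma Sup_miss_probs_nonneg: "0 \<le> Sup (insert 0 (miss_probs s n M \<epsilon> \<psi> \<gamma>))"
  by (intro cSup_upper bdd_above_miss_probs) auto

text \<open>Since validity of \<open>C\<close> is a statement about sequences, the supremum is replaced by its
  value along one sequence, up to a vanishing error.\<close>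

lemma ex_near_worst_alternative:
  assumes "\<gamma> \<in> linf_ball n M" "\<delta> > 0"
  shows "\<exists>\<kappa>\<in>linf_ball n M.
     Sup (insert 0 (miss_probs s n M \<epsilon> \<psi> \<gamma>)) \<le>
       (if linf_dist n \<kappa> \<gamma> \<ge> \<epsilon> then measure_pmf.prob (beta_model s n \<kappa>) {H. \<not> \<psi> H} else 0) + \<delta>"
proof -
  let ?S = "insert 0 (miss_probs s n M \<epsilon> \<psi> \<gamma>)"
  have "Sup ?S - \<delta> < Sup ?S" using assms by simp
  then obtain x where x: "x \<in> ?S" "Sup ?S - \<delta> < x"
    using less_cSupE[of "Sup ?S - \<delta>" ?S] by blast
  show ?thesis
  \<comment> \<open>A near-maximal value 0 may be just the inserted default. Then the supremum is at
    most \<open>\<delta>\<close>, and \<open>\<gamma>\<close> itself serves as witness whether or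
    not it is an alternative.\<close>
  proof (cases "x = 0")
    case True
    with x(2) have "Sup ?S \<le> \<delta>" by simp
    with assms(1) show ?thesis by (intro bexI[of _ \<gamma>]) (auto intro: add_increasing)
  next
    case False
    with x obtain \<kappa> where "\<kappa> \<in> linf_ball n M" "linf_dist n \<kappa> \<gamma> \<ge> \<epsilon>"
      "x = measure_pmf.prob (beta_model s n \<kappa>) {H. \<not> \<psi> H}" by auto
    with x(2) show ?thesis by (intro bexI[of _ \<kappa>]) auto
  qed
qed

section \<open>Power of the maximum test above the rate\<close>

lemma phi_max_powerful:
  assumes "filterlim (\<lambda>n. \<epsilon> n / rate s n) at_top sequentially"
    and valid: "valid_const s M B C"
    and \<gamma>: "\<And>n. \<gamma> n \<in> linf_ball n M"
  shows "(\<lambda>n. risk s n M (\<epsilon> n) (phi_max s n (B n) C (\<gamma> n)) (\<gamma> n)) \<longlonglongrightarrow> 0"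
proof -
  let ?\<phi> = "\<lambda>n. phi_max s n (B n) C (\<gamma> n)"
  let ?S = "\<lambda>n. Sup (insert 0 (miss_probs s n M (\<epsilon> n) (?\<phi> n) (\<gamma> n)))"
  let ?far = "\<lambda>\<kappa> n. measure_pmf.prob (beta_model s n (\<kappa> n))
                {H. \<not> linf_dist n (B n H) (\<kappa> n) \<le> C * rate s n}"
  have C: "C > 0" using valid by (simp add: valid_const_def)
  have far: "?far \<kappa> \<longlonglongrightarrow> 0" if "\<And>n. \<kappa> n \<in> linf_ball n M" for \<kappa>
  proof -
    have "(\<lambda>n. measure_pmf.prob (beta_model s n (\<kappa> n))
            {H. linf_dist n (B n H) (\<kappa> n) \<le> C * rate s n}) \<longlonglongrightarrow> 1"
      using valid that by (simp add: valid_const_def)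
    from tendsto_diff[OF tendsto_const[of 1] this] show ?thesis
      unfolding prob_not by simp
  qed
  let ?miss = "\<lambda>n \<kappa>. if linf_dist n \<kappa> (\<gamma> n) \<ge> \<epsilon> n
      then measure_pmf.prob (beta_model s n \<kappa>) {H. \<not> ?\<phi> n H} else 0"
  have "\<exists>\<kappa>\<in>linf_ball n M. ?S n \<le> ?miss n \<kappa> + inverse (real (Suc n))" for n
    by (rule ex_near_worst_alternative[OF \<gamma>]) simp
  then have "\<forall>n. \<exists>\<kappa>. \<kappa> \<in> linf_ball n M \<and> ?S n \<le> ?miss n \<kappa> + inverse (real (Suc n))"
    unfolding Bex_def by (rule allI)
  from choice[OF this] obtain \<kappa> where
    "\<forall>n. \<kappa> n \<in> linf_ball n M \<and> ?S n \<le> ?miss n (\<kappa> n) + inverse (real (Suc n))"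
    by (rule exE)
  then have \<kappa>: "\<And>n. \<kappa> n \<in> linf_ball n M"
    and near: "\<And>n. ?S n \<le> ?miss n (\<kappa> n) + inverse (real (Suc n))"
    by blast+
  \<comment> \<open>The factor 3 is 2 + 1: acceptance puts the estimate within
    \<open>2 * C * rate s n\<close> of \<open>\<gamma> n\<close>, and accuracy puts it within
    \<open>C * rate s n\<close> of the truth. Both together contradict a separation of three such
    units.\<close>
  have "\<forall>\<^sub>F n in sequentially. 3 * C * rate s n \<le> \<epsilon> n"
    by (rule filterlim_rate_times_const_le[OF assms(1)])
  then have upper: "\<forall>\<^sub>F n in sequentially. risk s n M (\<epsilon> n) (?\<phi> n) (\<gamma> n) \<le>
      ?far \<gamma> n + ?far \<kappa> n + inverse (real (Suc n))"
    using eventually_ge_at_top[of 2]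
  proof eventually_elim
    case (elim n)
    have r: "C * rate s n > 0" using C rate_pos[of n s] elim by simp
    \<comment> \<open>Rejection means a distance of at least \<open>2 * C * rate s n\<close>, which
      strictly exceeds \<open>C * rate s n\<close> because the latter is positive.\<close>
    have level: "measure_pmf.prob (beta_model s n (\<gamma> n)) {H. ?\<phi> n H} \<le> ?far \<gamma> n"
      using r by (intro measure_pmf.finite_measure_mono) (auto simp: phi_max_def)
    have "measure_pmf.prob (beta_model s n (\<kappa> n)) {H. \<not> ?\<phi> n H} \<le> ?far \<kappa> n"
      if d: "linf_dist n (\<kappa> n) (\<gamma> n) \<ge> \<epsilon> n"
    proof (intro measure_pmf.finite_measure_mono subsetI CollectI notI)
      fix H assume "H \<in> {H. \<not> ?\<phi> n H}" "linf_dist n (B n H) (\<kappa> n) \<le> C * rate s n"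
      then show False
        using linf_dist_triangle[of n "\<kappa> n" "\<gamma> n" "B n H"] d elim(1)
        by (simp add: phi_max_def)
    qed simp
    then have "?miss n (\<kappa> n) \<le> ?far \<kappa> n" by simp
    with level show ?case
      using near[of n] unfolding risk_def by linarith
  qed
  have lim: "(\<lambda>n. ?far \<gamma> n + ?far \<kappa> n + inverse (real (Suc n))) \<longlonglongrightarrow> 0"
    using tendsto_add[OF tendsto_add[OF far[of \<gamma>, OF \<gamma>] far[of \<kappa>, OF \<kappa>]] LIMSEQ_inverse_real_of_nat] by simp
  have lower: "\<forall>\<^sub>F n in sequentially. 0 \<le> risk s n M (\<epsilon> n) (?\<phi> n) (\<gamma> n)"
    unfolding risk_def using Sup_miss_probs_nonneg by (intro always_eventually) (simp add: add_nonneg_nonneg)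
  show ?thesis
    by (rule tendsto_sandwich[OF lower upper tendsto_const lim])
qed

section \<open>The chi-square bound\<close>

text \<open>Cauchy-Schwarz with weights \<open>sqrt (q x)\<close> bounds the squared deviation on
  \<open>A\<close> by the chi-square divergence from \<open>q\<close> of the uniform mixture
  \<open>R\<close> of the \<open>Q v\<close>. Expanding the square of the mixture yields a double
  sum of pairwise correlations.\<close>

lemma mixture_deviation_le_chi_square:
  fixes q :: "'a \<Rightarrow> real" and Q :: "'v \<Rightarrow> 'a \<Rightarrow> real"
  assumes fin: "finite \<Omega>" "finite V" and V: "V \<noteq> {}" and A: "A \<subseteq> \<Omega>"
    and q: "\<And>x. x \<in> \<Omega> \<Longrightarrow> q x > 0" "sum q \<Omega> = 1"
    and Q: "\<And>v. v \<in> V \<Longrightarrow> sum (Q v) \<Omega> = 1"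
  shows "((\<Sum>v\<in>V. sum (Q v) A) / card V - sum q A)\<^sup>2
         \<le> (\<Sum>v\<in>V. \<Sum>w\<in>V. \<Sum>x\<in>\<Omega>. Q v x * Q w x / q x) / (card V)\<^sup>2 - 1"
proof -
  define R where "R x = (\<Sum>v\<in>V. Q v x) / card V" for x
  have card: "real (card V) > 0" using fin V by (simp add: card_gt_0_iff)
  have R_sum: "sum R X = (\<Sum>v\<in>V. sum (Q v) X) / card V" for X
    unfolding R_def sum_divide_distrib[symmetric] by (subst sum.swap) simp
  have R1: "sum R \<Omega> = 1" using Q card by (simp add: R_sum)
  have finA: "finite A" using A fin finite_subset by blast
  have q0: "q x > 0" if "x \<in> A" for x using q(1) A that by blast
  have "(sum R A - sum q A)\<^sup>2 = (\<Sum>x\<in>A. sqrt (q x) * ((R x - q x) / sqrt (q x)))\<^sup>2"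
    by (simp add: sum_subtractf[symmetric] q0[THEN less_imp_neq, symmetric])
  also have "\<dots> \<le> (\<Sum>x\<in>A. (sqrt (q x))\<^sup>2) * (\<Sum>x\<in>A. ((R x - q x) / sqrt (q x))\<^sup>2)"
    by (rule Cauchy_Schwarz_ineq_sum)
  also have "\<dots> \<le> 1 * (\<Sum>x\<in>\<Omega>. ((R x - q x) / sqrt (q x))\<^sup>2)"
  proof (intro mult_mono)
    have "(\<Sum>x\<in>A. (sqrt (q x))\<^sup>2) = sum q A"
      using q A by (intro sum.cong) (auto intro!: real_sqrt_pow2 less_imp_le)
    also have "\<dots> \<le> sum q \<Omega>"
      using q A fin by (intro sum_mono2) (auto intro: less_imp_le)
    finally show "(\<Sum>x\<in>A. (sqrt (q x))\<^sup>2) \<le> 1" using q by simp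
  qed (auto intro!: sum_mono2 sum_nonneg fin A)
  also have "\<dots> = (\<Sum>x\<in>\<Omega>. R x * R x / q x - 2 * R x + q x)"
  proof -
    have "((R x - q x) / sqrt (q x))\<^sup>2 = R x * R x / q x - 2 * R x + q x" if "x \<in> \<Omega>" for x
      using q(1)[OF that] by (simp add: power_divide power2_eq_square field_simps)
    then show ?thesis by simp
  qed
  \<comment> \<open>Both \<open>R\<close> and \<open>q\<close> have total mass 1, so the last two
    terms contribute -2 + 1.\<close>
  also have "\<dots> = (\<Sum>x\<in>\<Omega>. R x * R x / q x) - 1"
    using R1 q(2) by (simp add: sum.distrib sum_subtractf sum_distrib_left[symmetric])
  also have "(\<Sum>x\<in>\<Omega>. R x * R x / q x)
      = (\<Sum>x\<in>\<Omega>. \<Sum>v\<in>V. \<Sum>w\<in>V. Q v x * Q w x / q x) / (card V)\<^sup>2"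
    unfolding R_def sum_divide_distrib
    by (intro sum.cong refl)
       (simp add: sum_product sum_divide_distrib[symmetric] power2_eq_square field_simps)
  also have "(\<Sum>x\<in>\<Omega>. \<Sum>v\<in>V. \<Sum>w\<in>V. Q v x * Q w x / q x)
      = (\<Sum>v\<in>V. \<Sum>w\<in>V. \<Sum>x\<in>\<Omega>. Q v x * Q w x / q x)"
    by (subst sum.swap, rule sum.cong[OF refl], subst sum.swap, rule refl)
  finally show ?thesis unfolding R_sum .
qed

section \<open>Product Bernoulli laws on the subsets of a finite set\<close>

definition bern_mass :: "'e set \<Rightarrow> ('e \<Rightarrow> real) \<Rightarrow> 'e set \<Rightarrow> real" where
  "bern_mass E p H = (\<Prod>e\<in>H. p e) * (\<Prod>e\<in>E - H. 1 - p e)"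

lemma sum_bern_mass: "finite E \<Longrightarrow> (\<Sum>H\<in>Pow E. bern_mass E p H) = 1"
  unfolding bern_mass_def using prod_add[of E p "\<lambda>e. 1 - p e"] by simp

lemma bern_mass_pos:
  assumes "\<And>e. e \<in> E \<Longrightarrow> 0 < p e" "\<And>e. e \<in> E \<Longrightarrow> p e < 1" "H \<subseteq> E"
  shows "0 < bern_mass E p H"
  unfolding bern_mass_def using assms by (intro mult_pos_pos prod_pos) auto

text \<open>The summand factors over the elements of \<open>E\<close>, so the sum over all subsets
  is a product of two-point sums, one per element. Each is 1 plus a covariance-like term, which
  vanishes as soon as \<open>a\<close> or \<open>b\<close> agrees with \<open>p\<close>
  there.\<close>

lemma sum_bern_mass_mult_divide:
  assumes "finite E" "\<And>e. e \<in> E \<Longrightarrow> 0 < p e" "\<And>e. e \<in> E \<Longrightarrow> p e < 1"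
  shows "(\<Sum>H\<in>Pow E. bern_mass E a H * bern_mass E b H / bern_mass E p H)
         = (\<Prod>e\<in>E. 1 + (a e - p e) * (b e - p e) / (p e * (1 - p e)))"
proof -
  have "(\<Sum>H\<in>Pow E. bern_mass E a H * bern_mass E b H / bern_mass E p H)
      = (\<Sum>H\<in>Pow E. (\<Prod>e\<in>H. a e * b e / p e) * (\<Prod>e\<in>E - H. (1 - a e) * (1 - b e) / (1 - p e)))"
    unfolding bern_mass_def by (simp add: prod_dividef prod.distrib mult_ac)
  also have "\<dots> = (\<Prod>e\<in>E. a e * b e / p e + (1 - a e) * (1 - b e) / (1 - p e))"
    by (rule prod_add[OF assms(1), symmetric])
  also have "\<dots> = (\<Prod>e\<in>E. 1 + (a e - p e) * (b e - p e) / (p e * (1 - p e)))"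
  proof (rule prod.cong[OF refl])
    fix e assume e: "e \<in> E"
    have "p e \<noteq> 0" "1 - p e \<noteq> 0" using assms(2,3)[OF e] by auto
    then show "a e * b e / p e + (1 - a e) * (1 - b e) / (1 - p e)
      = 1 + (a e - p e) * (b e - p e) / (p e * (1 - p e))"
      by (simp add: divide_simps) (simp add: algebra_simps)
  qed
  finally show ?thesis .
qed

section \<open>The hypergraph model as a product of Bernoulli laws\<close>

lemma finite_all_edges: "finite (all_edges s n)"
  unfolding all_edges_def by (rule finite_subset[of _ "Pow {1..n}"]) auto

lemma edge_prob_eq: "edge_prob \<beta> e = 1 - 1 / (1 + exp (\<Sum>v\<in>e. \<beta> v))"
  unfolding edge_prob_def by (simp add: field_simps add_pos_pos less_imp_neq[symmetric])

lemma edge_prob_pos: "0 < edge_prob \<beta> e"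
  unfolding edge_prob_def by (simp add: add_pos_pos)

lemma edge_prob_less_1: "edge_prob \<beta> e < 1"
  unfolding edge_prob_eq by (simp add: add_pos_pos)

text \<open>This finite-sum form is the one the chi-square bound needs. The model is supported on
  subsets of \<open>all_edges s n\<close>, and the mass of each is a product of Bernoulli
  masses.\<close>

lemma prob_beta_model:
  "measure_pmf.prob (beta_model s n \<beta>) {H. P H}
   = (\<Sum>H | H \<in> Pow (all_edges s n) \<and> P H. bern_mass (all_edges s n) (edge_prob \<beta>) H)"
proof -
  let ?E = "all_edges s n"
  let ?f = "\<lambda>X. {e \<in> ?E. X e}"
  let ?N = "Pi_pmf ?E False (\<lambda>e. bernoulli_pmf (edge_prob \<beta> e))"
  have pmf: "pmf (beta_model s n \<beta>) H = bern_mass ?E (edge_prob \<beta>) H" if H: "H \<subseteq> ?E" for H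
  proof -
    have "pmf (beta_model s n \<beta>) H = measure_pmf.prob ?N (?f -` {H})"
      unfolding beta_model_def by (rule pmf_map)
    \<comment> \<open>Functions in the support take the default \<open>False\<close> off the edge
      set, so the membership predicate of \<open>H\<close> is the only one of them that can map to
      \<open>H\<close>.\<close>
    also have "\<dots> = measure_pmf.prob ?N {\<lambda>e. e \<in> H}"
    proof (intro measure_pmf.finite_measure_eq_AE AE_pmfI)
      fix X assume "X \<in> set_pmf ?N"
      then have "\<And>e. e \<notin> ?E \<Longrightarrow> X e = False"
        using set_Pi_pmf_subset[OF finite_all_edges] by fastforce
      then show "X \<in> ?f -` {H} \<longleftrightarrow> X \<in> {\<lambda>e. e \<in> H}"
        using H by (auto simp: fun_eq_iff)
    qed auto
    also have "\<dots> = (\<Prod>e\<in>?E. pmf (bernoulli_pmf (edge_prob \<beta> e)) (e \<in> H))"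
      using H by (auto simp: measure_pmf_single pmf_Pi[OF finite_all_edges])
    also have "\<dots> = (\<Prod>e\<in>?E. if e \<in> H then edge_prob \<beta> e else 1 - edge_prob \<beta> e)"
      by (intro prod.cong) (auto simp: edge_prob_pos edge_prob_less_1 less_imp_le)
    also have "\<dots> = bern_mass ?E (edge_prob \<beta>) H"
      unfolding bern_mass_def using H finite_all_edges[of s n]
      by (subst prod.If_cases) (auto simp: Int_absorb1 Diff_eq)
    finally show ?thesis .
  qed
  have "measure_pmf.prob (beta_model s n \<beta>) {H. P H}
      = measure_pmf.prob (beta_model s n \<beta>) {H. H \<in> Pow ?E \<and> P H}"
    by (intro measure_pmf.finite_measure_eq_AE AE_pmfI) (auto simp: beta_model_def)
  also have "\<dots> = (\<Sum>H | H \<in> Pow ?E \<and> P H. pmf (beta_model s n \<beta>) H)"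
    using finite_all_edges by (intro measure_measure_pmf_finite) auto
  finally show ?thesis using pmf by simp
qed

section \<open>Perturbing one coordinate\<close>

text \<open>Removing \<open>T\<close> is injective on the edges that contain it and leaves a set of
  size \<open>s - card T\<close>. It is used with \<open>T\<close> a set of one or two
  vertices.\<close>

lemma card_edges_containing_le:
  assumes T: "finite T" "card T \<le> s"
  shows "card {e \<in> all_edges s n. T \<subseteq> e} \<le> n ^ (s - card T)"
proof -
  let ?F = "{f. f \<subseteq> {1..n} \<and> card f = s - card T}"
  have fin: "finite ?F" by (rule finite_subset[of _ "Pow {1..n}"]) auto
  have "card {e \<in> all_edges s n. T \<subseteq> e} \<le> card ?F"
  proof (rule card_inj_on_le[OF _ _ fin])
    show "inj_on (\<lambda>e. e - T) {e \<in> all_edges s n. T \<subseteq> e}"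
      by (rule inj_onI) blast
    show "(\<lambda>e. e - T) ` {e \<in> all_edges s n. T \<subseteq> e} \<subseteq> ?F"
      using T by (auto simp: all_edges_def card_Diff_subset)
  qed
  also have "\<dots> = n choose (s - card T)" by (simp add: n_subsets)
  also have "\<dots> \<le> n ^ (s - card T)"
    using binomial_le_pow[of "s - card T" n] by (cases "s - card T \<le> n") (auto simp: binomial_eq_0)
  finally show ?thesis .
qed

text \<open>For \<open>x \<le> y\<close> the difference has numerator
  \<open>exp y * (1 - exp (x - y))\<close>, which is at most \<open>exp y * (y - x)\<close>; the
  denominator absorbs \<open>exp y\<close>. The other case follows by symmetry.\<close>

lemma logistic_lipschitz:
  fixes x y :: real
  shows "\<bar>(1 - 1 / (1 + exp y)) - (1 - 1 / (1 + exp x))\<bar> \<le> \<bar>y - x\<bar>"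
proof -
  have *: "\<bar>(1 - 1 / (1 + exp y)) - (1 - 1 / (1 + exp x))\<bar> \<le> y - x" if "x \<le> y" for x y :: real
  proof -
    have nz: "1 + exp x > 0" "1 + exp y > 0" by (simp_all add: add_pos_pos)
    have "1 - exp (x - y) \<le> y - x"
      using exp_ge_add_one_self[of "x - y"] by linarith
    then have "exp y * (1 - exp (x - y)) \<le> exp y * (y - x)"
      by (intro mult_left_mono) auto
    then have "exp y - exp x \<le> exp y * (y - x)" by (simp add: exp_diff algebra_simps)
    also have "\<dots> \<le> ((1 + exp y) * (1 + exp x)) * (y - x)"
      using that by (intro mult_right_mono) (auto simp: algebra_simps)
    finally have "(exp y - exp x) / ((1 + exp y) * (1 + exp x)) \<le> y - x"
      using nz by (simp add: pos_divide_le_eq mult_ac)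
    moreover have "(1 - 1 / (1 + exp y)) - (1 - 1 / (1 + exp x))
        = (exp y - exp x) / ((1 + exp y) * (1 + exp x))"
      using nz by (simp add: field_simps)
    moreover have "0 \<le> (exp y - exp x) / ((1 + exp y) * (1 + exp x))"
      using nz that by simp
    ultimately show ?thesis by simp
  qed
  show ?thesis
    using *[of x y] *[of y x] by (cases "x \<le> y") (auto simp: abs_minus_commute)
qed

text \<open>The sum of \<open>\<beta>\<close> over an edge lies between \<open>- (s * M)\<close> and
  \<open>s * M\<close>, which keeps the edge probability and its complement away from 0.\<close>

lemma edge_prob_variance_ge:
  assumes e: "e \<in> all_edges s n" and \<beta>: "\<beta> \<in> linf_ball n M"
  shows "1 / (1 + exp (real s * M))\<^sup>2 \<le> edge_prob \<beta> e * (1 - edge_prob \<beta> e)"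
proof -
  let ?S = "\<Sum>v\<in>e. \<beta> v"
  have "\<bar>?S\<bar> \<le> (\<Sum>v\<in>e. \<bar>\<beta> v\<bar>)" by (rule sum_abs)
  also have "\<dots> \<le> (\<Sum>v\<in>e. M)"
    using e \<beta> by (intro sum_mono) (auto simp: all_edges_def linf_ball_def linf_norm_le_iff)
  also have "\<dots> = real s * M" using e by (simp add: all_edges_def)
  finally have S: "exp ?S \<le> exp (real s * M)" "exp (- ?S) \<le> exp (real s * M)" by auto
  have "edge_prob \<beta> e = 1 / (1 + exp (- ?S))"
    unfolding edge_prob_def by (simp add: exp_minus field_simps add_pos_pos less_imp_neq[symmetric])
  then have "edge_prob \<beta> e \<ge> 1 / (1 + exp (real s * M))"
    using S by (simp add: frac_le add_pos_pos)
  moreover have "1 - edge_prob \<beta> e \<ge> 1 / (1 + exp (real s * M))"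
    using S unfolding edge_prob_eq by (simp add: frac_le add_pos_pos)
  ultimately have "1 / (1 + exp (real s * M)) * (1 / (1 + exp (real s * M)))
      \<le> edge_prob \<beta> e * (1 - edge_prob \<beta> e)"
    by (intro mult_mono) (auto simp: add_pos_pos edge_prob_pos less_imp_le)
  then show ?thesis by (simp add: power2_eq_square)
qed

text \<open>Moving towards 0, possibly past it, keeps the coordinate in \<open>[-M, M]\<close>
  whenever \<open>0 \<le> \<epsilon> \<le> M\<close>, even if \<open>\<gamma>\<close> lies on the
  boundary of the ball.\<close>

definition bump :: "real \<Rightarrow> (nat \<Rightarrow> real) \<Rightarrow> nat \<Rightarrow> nat \<Rightarrow> real" where
  "bump \<epsilon> \<gamma> v = \<gamma>(v := \<gamma> v + (if \<gamma> v \<ge> 0 then - \<epsilon> else \<epsilon>))"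

lemma bump_in_linf_ball:
  assumes "\<gamma> \<in> linf_ball n M" "v \<in> {1..n}" "0 \<le> \<epsilon>" "\<epsilon> \<le> M"
  shows "bump \<epsilon> \<gamma> v \<in> linf_ball n M"
proof -
  have "\<bar>\<gamma> v\<bar> \<le> M" using assms by (auto simp: linf_ball_def linf_norm_le_iff)
  then have "\<bar>bump \<epsilon> \<gamma> v v\<bar> \<le> M" using assms by (auto simp: bump_def)
  with assms show ?thesis
    by (auto simp: bump_def linf_ball_def linf_norm_le_iff vecs_def PiE_def extensional_def)
qed

lemma linf_dist_bump:
  assumes "v \<in> {1..n}" "0 \<le> \<epsilon>"
  shows "\<epsilon> \<le> linf_dist n (bump \<epsilon> \<gamma> v) \<gamma>"
  using abs_le_linf_norm[OF assms(1), of "\<lambda>u. bump \<epsilon> \<gamma> v u - \<gamma> u"] assms(2)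
  by (auto simp: linf_dist_def bump_def split: if_splits)

lemma edge_prob_bump_notin: "v \<notin> e \<Longrightarrow> edge_prob (bump \<epsilon> \<gamma> v) e = edge_prob \<gamma> e"
proof -
  assume "v \<notin> e"
  then have "(\<Sum>u\<in>e. bump \<epsilon> \<gamma> v u) = (\<Sum>u\<in>e. \<gamma> u)"
    by (intro sum.cong) (auto simp: bump_def)
  then show ?thesis by (simp add: edge_prob_def)
qed

lemma edge_prob_bump_diff:
  assumes "finite e" "0 \<le> \<epsilon>"
  shows "\<bar>edge_prob (bump \<epsilon> \<gamma> v) e - edge_prob \<gamma> e\<bar> \<le> \<epsilon>"
proof -
  have "(\<Sum>u\<in>e. bump \<epsilon> \<gamma> v u) - (\<Sum>u\<in>e. \<gamma> u)
      = (\<Sum>u\<in>e. if u = v then (if \<gamma> v \<ge> 0 then - \<epsilon> else \<epsilon>) else 0)"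
    unfolding sum_subtractf[symmetric] by (intro sum.cong) (auto simp: bump_def)
  also have "\<bar>\<dots>\<bar> \<le> \<epsilon>" using assms by (simp add: sum.delta)
  finally show ?thesis
    using logistic_lipschitz[of "\<Sum>u\<in>e. bump \<epsilon> \<gamma> v u" "\<Sum>u\<in>e. \<gamma> u"]
    unfolding edge_prob_eq by linarith
qed

text \<open>Only edges containing both \<open>v\<close> and \<open>w\<close> have a factor different
  from 1, and it differs from 1 by at most \<open>\<epsilon>\<close> squared over the Bernoulli
  variance. Writing the exponent with \<open>card {v, w}\<close> treats equal and distinct vertices
  at once.\<close>

lemma bump_correlation_le:
  assumes \<gamma>: "\<gamma> \<in> linf_ball n M" and \<epsilon>: "0 \<le> \<epsilon>" and T: "card {v, w} \<le> s"
  shows "(\<Sum>H\<in>Pow (all_edges s n).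
            bern_mass (all_edges s n) (edge_prob (bump \<epsilon> \<gamma> v)) H *
            bern_mass (all_edges s n) (edge_prob (bump \<epsilon> \<gamma> w)) H /
            bern_mass (all_edges s n) (edge_prob \<gamma>) H)
         \<le> exp ((1 + exp (real s * M))\<^sup>2 * \<epsilon>\<^sup>2 * real n ^ (s - card {v, w}))"
proof -
  let ?E = "all_edges s n" and ?K = "(1 + exp (real s * M))\<^sup>2"
  let ?F = "{e \<in> ?E. {v, w} \<subseteq> e}"
  let ?a = "edge_prob (bump \<epsilon> \<gamma> v)" and ?b = "edge_prob (bump \<epsilon> \<gamma> w)" and ?p = "edge_prob \<gamma>"
  let ?t = "\<lambda>e. (?a e - ?p e) * (?b e - ?p e) / (?p e * (1 - ?p e))"
  have K: "?K > 0" by (intro zero_less_power add_pos_pos) auto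
  have t: "\<bar>?t e\<bar> \<le> ?K * \<epsilon>\<^sup>2" if e: "e \<in> ?E" for e
  proof -
    have fe: "finite e" using e by (auto simp: all_edges_def intro: finite_subset)
    have var: "1 / ?K \<le> ?p e * (1 - ?p e)" by (rule edge_prob_variance_ge[OF e \<gamma>])
    have "\<bar>(?a e - ?p e) * (?b e - ?p e)\<bar> \<le> \<epsilon> * \<epsilon>"
      unfolding abs_mult by (intro mult_mono edge_prob_bump_diff fe \<epsilon>) auto
    moreover have "\<bar>?p e * (1 - ?p e)\<bar> = ?p e * (1 - ?p e)"
      using edge_prob_pos[of \<gamma> e] edge_prob_less_1[of \<gamma> e] by simp
    ultimately have "\<bar>?t e\<bar> \<le> \<epsilon> * \<epsilon> / (1 / ?K)"
      unfolding abs_divide using var K \<epsilon> by (intro frac_le) (auto simp: zero_le_mult_iff)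
    then show ?thesis by (simp add: power2_eq_square mult_ac)
  qed
  have t0: "?t e = 0" if "e \<in> ?E - ?F" for e
    using that edge_prob_bump_notin[of v e] edge_prob_bump_notin[of w e] by auto
  \<comment> \<open>Nonnegativity allows the factors to be compared with exponentials inside the
    product. It is visible in the two-point form of the factor.\<close>
  have nonneg: "0 \<le> 1 + ?t e" for e
  proof -
    have "1 + ?t e = ?a e * ?b e / ?p e + (1 - ?a e) * (1 - ?b e) / (1 - ?p e)"
      using edge_prob_pos[of \<gamma> e] edge_prob_less_1[of \<gamma> e]
      by (simp add: divide_simps) (simp add: algebra_simps)
    also have "\<dots> \<ge> 0"
      using edge_prob_pos edge_prob_less_1 by (intro add_nonneg_nonneg divide_nonneg_nonneg mult_nonneg_nonneg) (auto intro: less_imp_le)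
    finally show ?thesis .
  qed
  have "(\<Sum>H\<in>Pow ?E. bern_mass ?E ?a H * bern_mass ?E ?b H / bern_mass ?E ?p H) = (\<Prod>e\<in>?E. 1 + ?t e)"
    by (intro sum_bern_mass_mult_divide finite_all_edges edge_prob_pos edge_prob_less_1)
  also have "\<dots> \<le> (\<Prod>e\<in>?E. exp (?t e))"
    using nonneg by (intro prod_mono) (auto intro: exp_ge_add_one_self)
  also have "\<dots> = exp (\<Sum>e\<in>?E. ?t e)" by (simp add: exp_sum finite_all_edges)
  also have "(\<Sum>e\<in>?E. ?t e) = (\<Sum>e\<in>?F. ?t e)"
    using finite_all_edges t0 by (intro sum.mono_neutral_right) auto
  also have "\<dots> \<le> (\<Sum>e\<in>?F. ?K * \<epsilon>\<^sup>2)"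
    by (intro sum_mono order_trans[OF abs_ge_self t]) auto
  also have "\<dots> = real (card ?F) * (?K * \<epsilon>\<^sup>2)" by simp
  also have "\<dots> \<le> real (n ^ (s - card {v, w})) * (?K * \<epsilon>\<^sup>2)"
    by (intro mult_right_mono of_nat_mono card_edges_containing_le T) auto
  finally show ?thesis by (simp add: mult_ac)
qed

section \<open>Lower bound on the risk by a mixture of alternatives\<close>

text \<open>The bumped parameters are alternatives, so the supremum dominates the average of their
  miss probabilities. Their mixture rejects with the null probability up to the root of the
  chi-square bound, so the two errors add up to 1 up to that root.\<close>

lemma risk_ge:
  assumes s: "s \<ge> 2" and n: "n \<ge> 1" and \<gamma>: "\<gamma> \<in> linf_ball n M" and \<epsilon>: "0 \<le> \<epsilon>" "\<epsilon> \<le> M"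
  shows "risk s n M \<epsilon> \<psi> \<gamma> \<ge> 1 - sqrt (exp ((1 + exp (real s * M))\<^sup>2 * \<epsilon>\<^sup>2 * real n ^ (s - 1)) / n
           + exp ((1 + exp (real s * M))\<^sup>2 * \<epsilon>\<^sup>2 * real n ^ (s - 2)) - 1)"
proof -
  let ?E = "all_edges s n" and ?V = "{1..n}"
  let ?A = "{H. H \<in> Pow ?E \<and> \<psi> H}"
  let ?q = "bern_mass ?E (edge_prob \<gamma>)"
  let ?Q = "\<lambda>v. bern_mass ?E (edge_prob (bump \<epsilon> \<gamma> v))"
  let ?X = "exp ((1 + exp (real s * M))\<^sup>2 * \<epsilon>\<^sup>2 * real n ^ (s - 1))"
  let ?Y = "exp ((1 + exp (real s * M))\<^sup>2 * \<epsilon>\<^sup>2 * real n ^ (s - 2))"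
  let ?S = "Sup (insert 0 (miss_probs s n M \<epsilon> \<psi> \<gamma>))"
  let ?m = "(\<Sum>v\<in>?V. sum (?Q v) ?A) / n"
  have dev: "(?m - sum ?q ?A)\<^sup>2
      \<le> (\<Sum>v\<in>?V. \<Sum>w\<in>?V. \<Sum>H\<in>Pow ?E. ?Q v H * ?Q w H / ?q H) / (real n)\<^sup>2 - 1"
    using mixture_deviation_le_chi_square[of "Pow ?E" ?V ?A ?q ?Q] n
      finite_all_edges[of s n] sum_bern_mass[OF finite_all_edges[of s n]]
      bern_mass_pos[of ?E "edge_prob \<gamma>", OF edge_prob_pos edge_prob_less_1]
    by auto
  \<comment> \<open>Adding \<open>?Y\<close> on the diagonal as well costs little and makes the
    double sum exactly \<open>n * ?X\<close> plus \<open>n\<close> squared times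
    \<open>?Y\<close>.\<close>
  have "(\<Sum>v\<in>?V. \<Sum>w\<in>?V. \<Sum>H\<in>Pow ?E. ?Q v H * ?Q w H / ?q H)
      \<le> (\<Sum>v\<in>?V. \<Sum>w\<in>?V. (if w = v then ?X else 0) + ?Y)"
  proof (intro sum_mono)
    fix v w
    show "(\<Sum>H\<in>Pow ?E. ?Q v H * ?Q w H / ?q H) \<le> (if w = v then ?X else 0) + ?Y"
    proof (cases "w = v")
      case True
      have "(\<Sum>H\<in>Pow ?E. ?Q v H * ?Q w H / ?q H) \<le> ?X"
        using bump_correlation_le[OF \<gamma> \<epsilon>(1), of v w s] s True by simp
      also have "?X \<le> ?X + ?Y" by simp
      finally show ?thesis using True by simp
    next
      case False
      then have "card {v, w} = 2" by auto
      with False show ?thesis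
        using bump_correlation_le[OF \<gamma> \<epsilon>(1), of v w s] s by (simp only: if_False add_0)
    qed
  qed
  also have "\<dots> = n * ?X + (real n)\<^sup>2 * ?Y"
    by (simp add: sum.distrib sum.delta' power2_eq_square algebra_simps)
  finally have "(\<Sum>v\<in>?V. \<Sum>w\<in>?V. \<Sum>H\<in>Pow ?E. ?Q v H * ?Q w H / ?q H) / (real n)\<^sup>2
      \<le> (n * ?X + (real n)\<^sup>2 * ?Y) / (real n)\<^sup>2"
    by (rule divide_right_mono) simp
  also have "\<dots> = ?X / n + ?Y" using n by (simp add: add_divide_distrib power2_eq_square)
  finally have "(?m - sum ?q ?A)\<^sup>2 \<le> ?X / n + ?Y - 1" using dev by linarith
  then have dev': "\<bar>?m - sum ?q ?A\<bar> \<le> sqrt (?X / n + ?Y - 1)"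
    by (intro real_le_rsqrt) (simp only: power2_abs)
  have "1 - sum (?Q v) ?A \<le> ?S" if "v \<in> ?V" for v
    using miss_prob_le_Sup[where s=s and \<psi>=\<psi>, OF bump_in_linf_ball[OF \<gamma> that \<epsilon>] linf_dist_bump[OF that \<epsilon>(1)]]
    unfolding prob_not prob_beta_model by simp
  then have "(\<Sum>v\<in>?V. 1 - ?S) \<le> (\<Sum>v\<in>?V. sum (?Q v) ?A)"
    by (intro sum_mono) (simp add: algebra_simps)
  then have "1 - ?S \<le> ?m" using n by (simp add: field_simps)
  moreover have "measure_pmf.prob (beta_model s n \<gamma>) {H. \<psi> H} = sum ?q ?A"
    by (rule prob_beta_model)
  ultimately show ?thesis using dev' unfolding risk_def by linarith
qed

section \<open>Asymptotic powerlessness\<close>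

text \<open>With \<open>?u\<close> tending to 0, the first exponent is \<open>?u n * ln n\<close>;
  division by \<open>n\<close> turns it into \<open>(?u n - 1) * ln n\<close>, which tends to minus
  infinity. The second exponent is \<open>?u n * (ln n / n)\<close>, so its exponential tends to 1
  and cancels the -1.\<close>

lemma chi_square_bound_tendsto_0:
  assumes s: "s \<ge> 2" and lim: "(\<lambda>n. \<epsilon> n / rate s n) \<longlonglongrightarrow> 0"
  shows "(\<lambda>n. exp (K * (\<epsilon> n)\<^sup>2 * real n ^ (s - 1)) / n + exp (K * (\<epsilon> n)\<^sup>2 * real n ^ (s - 2)) - 1) \<longlonglongrightarrow> 0"
proof -
  let ?u = "\<lambda>n. K * (\<epsilon> n / rate s n)\<^sup>2"
  have u: "?u \<longlonglongrightarrow> 0"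
    using tendsto_mult[OF tendsto_const[of K] tendsto_power[OF lim, of 2]] by simp
  have sq: "(\<epsilon> n)\<^sup>2 * real n ^ (s - 1) = (\<epsilon> n / rate s n)\<^sup>2 * ln n" if n: "n \<ge> 2" for n
  proof -
    have "(rate s n)\<^sup>2 = ln n / real n ^ (s - 1)"
      unfolding rate_def using n by (intro real_sqrt_pow2) auto
    moreover have "ln (real n) > 0" using n by simp
    ultimately show ?thesis using n by (simp add: power_divide)
  qed
  have e1: "\<forall>\<^sub>F n in sequentially. exp ((?u n - 1) * ln n) = exp (K * (\<epsilon> n)\<^sup>2 * real n ^ (s - 1)) / n"
    using eventually_ge_at_top[of 2]
  proof eventually_elim
    case (elim n)
    have "(?u n - 1) * ln n = K * ((\<epsilon> n)\<^sup>2 * real n ^ (s - 1)) - ln n"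
      unfolding sq[OF elim] by (simp add: algebra_simps)
    with elim show ?case by (simp add: exp_diff mult_ac)
  qed
  have e2: "\<forall>\<^sub>F n in sequentially. exp (?u n * (ln n / n)) = exp (K * (\<epsilon> n)\<^sup>2 * real n ^ (s - 2))"
    using eventually_ge_at_top[of 2]
  proof eventually_elim
    case (elim n)
    have "real n ^ (s - 1) = real n ^ (s - 2) * n"
      using s by (simp add: power_Suc2[symmetric] Suc_diff_le[symmetric] numeral_2_eq_2 del: power_Suc)
    then have "(\<epsilon> n)\<^sup>2 * real n ^ (s - 2) * n = (\<epsilon> n / rate s n)\<^sup>2 * ln n"
      using sq[OF elim] by (simp only: mult.assoc)
    then have "(\<epsilon> n)\<^sup>2 * real n ^ (s - 2) = (\<epsilon> n / rate s n)\<^sup>2 * ln n / n"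
      using elim by (subst nonzero_eq_divide_eq) auto
    then show ?case by (simp add: mult_ac)
  qed
  have ln: "filterlim (\<lambda>n. ln (real n)) at_top sequentially"
    by (rule filterlim_compose[OF ln_at_top filterlim_real_sequentially])
  have "filterlim (\<lambda>n. (?u n - 1) * ln n) at_bot sequentially"
    using tendsto_diff[OF u tendsto_const[of 1]]
    by (intro filterlim_tendsto_neg_mult_at_bot[OF _ _ ln]) auto
  then have "(\<lambda>n. exp ((?u n - 1) * ln n)) \<longlonglongrightarrow> 0"
    by (rule filterlim_compose[OF exp_at_bot])
  with e1 have l1: "(\<lambda>n. exp (K * (\<epsilon> n)\<^sup>2 * real n ^ (s - 1)) / n) \<longlonglongrightarrow> 0"
    by (rule Lim_transform_eventually[rotated])
  have "(\<lambda>n. exp (?u n * (ln n / n))) \<longlonglongrightarrow> exp (0 * 0)"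
    by (intro tendsto_exp tendsto_mult u lim_ln_over_n)
  with e2 have l2: "(\<lambda>n. exp (K * (\<epsilon> n)\<^sup>2 * real n ^ (s - 2))) \<longlonglongrightarrow> exp (0 * 0)"
    by (rule Lim_transform_eventually[rotated])
  from tendsto_diff[OF tendsto_add[OF l1 l2] tendsto_const[of 1]] show ?thesis by simp
qed

lemma rate_tendsto_0:
  assumes s: "s \<ge> 2"
  shows "rate s \<longlonglongrightarrow> 0"
proof -
  have "(\<lambda>n. sqrt (ln (real n) / n)) \<longlonglongrightarrow> sqrt 0"
    by (intro tendsto_real_sqrt lim_ln_over_n)
  moreover have "\<forall>\<^sub>F n in sequentially. norm (rate s n) \<le> sqrt (ln (real n) / n)"
    using eventually_ge_at_top[of 1]
  proof eventually_elim
    case (elim n)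
    have "real n ^ 1 \<le> real n ^ (s - 1)" using s elim by (intro power_increasing) auto
    with elim show ?case
      unfolding rate_def by (auto intro!: divide_left_mono)
  qed
  ultimately show ?thesis by (auto intro: Lim_null_comparison)
qed

lemma all_tests_powerless:
  assumes s: "s \<ge> 2" and M: "M > 0" and \<epsilon>: "\<And>n. \<epsilon> n > 0"
    and lim: "(\<lambda>n. \<epsilon> n / rate s n) \<longlonglongrightarrow> 0"
  shows "\<exists>\<gamma>. (\<forall>n. \<gamma> n \<in> linf_ball n M) \<and> (\<lambda>n. risk s n M (\<epsilon> n) (\<psi> n) (\<gamma> n)) \<longlonglongrightarrow> 1"
proof -
  let ?f = "\<lambda>n \<gamma>. measure_pmf.prob (beta_model s n \<gamma>) {H. \<psi> n H}"
  let ?\<chi> = "\<lambda>n. exp ((1 + exp (real s * M))\<^sup>2 * (\<epsilon> n)\<^sup>2 * real n ^ (s - 1)) / n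
           + exp ((1 + exp (real s * M))\<^sup>2 * (\<epsilon> n)\<^sup>2 * real n ^ (s - 2)) - 1"
  \<comment> \<open>An approximate minimizer of the rejection probability suffices, so attainment of
    the infimum is not at issue; the error \<open>1 / (n + 1)\<close> vanishes in the limit.\<close>
  have "\<exists>\<gamma>. \<gamma> \<in> linf_ball n M \<and> (\<forall>\<gamma>'\<in>linf_ball n M. ?f n \<gamma> \<le> ?f n \<gamma>' + inverse (real (Suc n)))" for n
  proof -
    let ?R = "?f n ` linf_ball n M"
    \<comment> \<open>The zero vector, in its extensional form, shows that the ball is
      nonempty.\<close>
    have "(\<lambda>v. if v \<in> {1..n} then 0 else undefined) \<in> linf_ball n M"
      using M by (auto simp: linf_ball_def vecs_def linf_norm_le_iff PiE_def extensional_def)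
    then have ne: "?R \<noteq> {}" by blast
    have bdd: "bdd_below ?R" by (rule bdd_belowI[of _ 0]) auto
    have "Inf ?R < Inf ?R + inverse (real (Suc n))" by simp
    then obtain \<gamma> where "\<gamma> \<in> linf_ball n M" "?f n \<gamma> < Inf ?R + inverse (real (Suc n))"
      using cInf_lessD[OF ne] by blast
    moreover have "Inf ?R \<le> ?f n \<gamma>'" if "\<gamma>' \<in> linf_ball n M" for \<gamma>'
      using bdd that by (intro cInf_lower) auto
    ultimately show ?thesis by (intro exI[of _ \<gamma>]) (auto intro: order_trans[OF less_imp_le])
  qed
  then obtain \<gamma> where \<gamma>: "\<And>n. \<gamma> n \<in> linf_ball n M"
    and min: "\<And>n \<gamma>'. \<gamma>' \<in> linf_ball n M \<Longrightarrow> ?f n (\<gamma> n) \<le> ?f n \<gamma>' + inverse (real (Suc n))"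
    by metis
  \<comment> \<open>Every parameter in the ball rejects at least as often as
    \<open>\<gamma> n\<close>, up to the error, so each miss probability is at most
    \<open>1 - ?f n (\<gamma> n)\<close> plus the error.\<close>
  have upper: "risk s n M (\<epsilon> n) (\<psi> n) (\<gamma> n) \<le> 1 + inverse (real (Suc n))" for n
  proof -
    have "Sup (insert 0 (miss_probs s n M (\<epsilon> n) (\<psi> n) (\<gamma> n))) \<le> 1 - ?f n (\<gamma> n) + inverse (real (Suc n))"
      by (intro Sup_miss_probs_le) (auto simp: prob_not intro!: add_nonneg_nonneg dest: min)
    then show ?thesis unfolding risk_def by simp
  qed
  \<comment> \<open>Eventually \<open>\<epsilon> n < M\<close>, as is required for the bumped
    parameters to stay in the ball.\<close>
  have "\<epsilon> \<longlonglongrightarrow> 0"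
  proof -
    have "(\<lambda>n. \<epsilon> n / rate s n * rate s n) \<longlonglongrightarrow> 0"
      using tendsto_mult[OF lim rate_tendsto_0[OF s]] by simp
    moreover have "\<forall>\<^sub>F n in sequentially. \<epsilon> n / rate s n * rate s n = \<epsilon> n"
      using eventually_ge_at_top[of 2]
    proof eventually_elim
      case (elim n)
      then show ?case using rate_pos[of n s] by simp
    qed
    ultimately show ?thesis by (rule Lim_transform_eventually)
  qed
  then have "\<forall>\<^sub>F n in sequentially. \<epsilon> n < M" using M by (rule order_tendstoD)
  then have lower: "\<forall>\<^sub>F n in sequentially. 1 - sqrt (?\<chi> n) \<le> risk s n M (\<epsilon> n) (\<psi> n) (\<gamma> n)"
    using eventually_ge_at_top[of 1]
  proof eventually_elim
    case (elim n)
    then show ?case using \<epsilon>[of n] by (intro risk_ge s \<gamma>) auto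
  qed
  have "(\<lambda>n. 1 - sqrt (?\<chi> n)) \<longlonglongrightarrow> 1"
    using tendsto_diff[OF tendsto_const[of 1] tendsto_real_sqrt[OF chi_square_bound_tendsto_0[OF s lim]]] by simp
  moreover have "(\<lambda>n. 1 + inverse (real (Suc n))) \<longlonglongrightarrow> 1"
    using tendsto_add[OF tendsto_const[of 1] LIMSEQ_inverse_real_of_nat] by simp
  ultimately have "(\<lambda>n. risk s n M (\<epsilon> n) (\<psi> n) (\<gamma> n)) \<longlonglongrightarrow> 1"
    by (rule tendsto_sandwich[OF lower always_eventually[OF allI[OF upper]]])
  with \<gamma> show ?thesis by blast
qed

theorem theorem3p4:
  fixes s :: nat and M :: real and \<epsilon> :: "nat \<Rightarrow> real"
    and betahat :: "nat \<Rightarrow> nat set set \<Rightarrow> nat \<Rightarrow> real"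
  assumes "s \<ge> 2" and "M > 0"
    and "\<And>n. \<epsilon> n > 0"
    and "\<And>n. is_ML_estimator s n (betahat n)"
  shows "(filterlim (\<lambda>n. \<epsilon> n / rate s n) at_top sequentially \<longrightarrow>
            (\<forall>C. valid_const s M betahat C \<longrightarrow>
              (\<forall>\<gamma>. (\<forall>n. \<gamma> n \<in> linf_ball n M) \<longrightarrow>
                (\<lambda>n. risk s n M (\<epsilon> n) (phi_max s n (betahat n) C (\<gamma> n)) (\<gamma> n)) \<longlonglongrightarrow> 0)))
       \<and> ((\<lambda>n. \<epsilon> n / rate s n) \<longlonglongrightarrow> 0 \<longrightarrow>
            (\<forall>\<psi> :: nat \<Rightarrow> nat set set \<Rightarrow> bool. \<exists>\<gamma>. (\<forall>n. \<gamma> n \<in> linf_ball n M) \<and>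
                (\<lambda>n. risk s n M (\<epsilon> n) (\<psi> n) (\<gamma> n)) \<longlonglongrightarrow> 1))"
proof (intro conjI impI allI)
  fix C \<gamma>
  assume "filterlim (\<lambda>n. \<epsilon> n / rate s n) at_top sequentially" "valid_const s M betahat C"
    and "\<forall>n. \<gamma> n \<in> linf_ball n M"
  then show "(\<lambda>n. risk s n M (\<epsilon> n) (phi_max s n (betahat n) C (\<gamma> n)) (\<gamma> n)) \<longlonglongrightarrow> 0"
    using phi_max_powerful by blast
next
  fix \<psi> :: "nat \<Rightarrow> nat set set \<Rightarrow> bool"
  assume "(\<lambda>n. \<epsilon> n / rate s n) \<longlonglongrightarrow> 0"
  then show "\<exists>\<gamma>. (\<forall>n. \<gamma> n \<in> linf_ball n M) \<and>
      (\<lambda>n. risk s n M (\<epsilon> n) (\<psi> n) (\<gamma> n)) \<longlonglongrightarrow> 1"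
    by (rule all_tests_powerless[OF assms(1,2,3)])
qed

end
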